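(* Let $k=k(n)$ satisfy $k = o(n^{1/100})$, and let $H_1,\ldots,H_k$ be Hamilton cycles in the complete graph $K_n$, each chosen independently and uniformly at random among all Hamilton cycles of $K_n$. Then the probability that $H_1,\ldots,H_k$ are pairwise edge-disjoint is $$(1+o(1))\,e^{-2\binom{k}{2}}$$ as $n\to\infty$.
   Context: A Hamilton cycle in $K_n$ is a cycle passing through all $n$ vertices; $K_n$ has $(n-1)!/2$ of them. Asymptotic notation refers to $n\to\infty$. *)

theory Defs
  imports "HOL-Probability.Probability" "HOL-Library.Landau_Symbols"
begin

definition complete_graph :: "nat \<Rightarrow> nat set set" where
  "complete_graph n = {e. e \<subseteq> {..<n} \<and> card e = 2}"

definition cycle_edges :: "'a list \<Rightarrow> 'a set set" where
  "cycle_edges vs = {{vs ! i, vs ! (Suc i mod length vs)} | i. i < length vs}"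

text \<open>
  A Hamilton cycle is identified with its edge set, so the \<open>2n\<close> vertex lists that traverse the
  same cycle (choice of starting point and direction) count only once.
\<close>

definition hamilton_cycles :: "'a set \<Rightarrow> 'a set set \<Rightarrow> 'a set set set" where
  "hamilton_cycles V E =
     {cycle_edges vs | vs. 3 \<le> length vs \<and> distinct vs \<and> set vs = V \<and> cycle_edges vs \<subseteq> E}"

text \<open>
  For \<open>n < 3\<close> there is no Hamilton cycle and the value is unspecified.
\<close>

definition random_hamilton_cycles :: "nat \<Rightarrow> nat \<Rightarrow> (nat \<Rightarrow> nat set set) pmf" where
  "random_hamilton_cycles n k =
     Pi_pmf {1..k} {} (\<lambda>_. pmf_of_set (hamilton_cycles {..<n} (complete_graph n)))"

end

theory Submission
  imports Defs "HOL-Combinatorics.Multiset_Permutations" "HOL-Real_Asymp.Real_Asymp"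
begin

text \<open>
  Choose the cycles one after the other: it suffices to show that a random Hamilton cycle avoids a
  given \<open>2k\<close>-regular graph \<open>G\<close> with \<open>kn\<close> edges with probability \<open>exp (- 2k + O(k\<^sup>2 / n))\<close>.
  Forbid the edges of \<open>G\<close> one at a time. Each of the \<open>kn\<close> steps multiplies the number of remaining
  cycles by \<open>1 - q\<close>, where \<open>q\<close> is the fraction of the cycles avoiding the part \<open>F\<close> of \<open>G\<close> treated so
  far that contain the next edge \<open>uv\<close>; one needs \<open>q = 2/n + O(k / n\<^sup>2)\<close>.

  This comes from the switching that replaces the edges \<open>uv\<close>, \<open>xy\<close> of a cycle by \<open>ux\<close>, \<open>vy\<close>.
  A cycle through \<open>uv\<close> admits \<open>n - O(k)\<close> switchings that create no edge of \<open>F\<close>. Conversely a cycle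
  avoiding \<open>uv\<close> arises in two ways, unless the edge \<open>xy\<close> to be restored lies in \<open>F\<close>; the first bound,
  applied to two edges in turn, shows that the latter happens only for a fraction \<open>O(k / n)\<close> of the
  cycles. Cycles are counted through their vertex orders, all cycles having equally many of them.
\<close>

section \<open>Edges of paths and cycles\<close>

fun path_edges :: "'a list \<Rightarrow> 'a set set" where
  "path_edges (x # y # zs) = insert {x, y} (path_edges (y # zs))"
| "path_edges _ = {}"

lemma path_edges_append:
  "xs \<noteq> [] \<Longrightarrow> ys \<noteq> [] \<Longrightarrow>
    path_edges (xs @ ys) = insert {last xs, hd ys} (path_edges xs \<union> path_edges ys)"
  by (induction xs rule: path_edges.induct) (auto simp: neq_Nil_conv)

lemma path_edges_rev: "path_edges (rev xs) = path_edges xs"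
proof (induction xs rule: path_edges.induct)
  case (1 x y zs)
  have "path_edges (rev (x # y # zs)) = insert {last (rev (y # zs)), x} (path_edges (rev (y # zs)) \<union> path_edges [x])"
    using path_edges_append[of "rev (y # zs)" "[x]"] by simp
  then show ?case using 1 by (simp add: insert_commute)
qed auto

lemma path_edges_subset_Pow: "path_edges xs \<subseteq> Pow (set xs)"
  by (induction xs rule: path_edges.induct) auto

lemma path_edges_conv_nth: "path_edges xs = {{xs ! i, xs ! Suc i} | i. Suc i < length xs}"
proof (induction xs rule: path_edges.induct)
  case (1 x y zs)
  have "{{(x # y # zs) ! i, (x # y # zs) ! Suc i} | i. Suc i < length (x # y # zs)} =
     insert {x, y} {{(y # zs) ! i, (y # zs) ! Suc i} | i. Suc i < length (y # zs)}" (is "?A = ?B")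
  proof
    show "?A \<subseteq> ?B"
    proof
      fix e assume "e \<in> ?A"
      then obtain i where i: "e = {(x # y # zs) ! i, (x # y # zs) ! Suc i}" "Suc i < length (x # y # zs)"
        by blast
      then show "e \<in> ?B" by (cases i) auto
    qed
    have "e \<in> ?A" if e: "e = {(y # zs) ! i, (y # zs) ! Suc i}" "Suc i < length (y # zs)" for e i
    proof -
      have "e = {(x # y # zs) ! Suc i, (x # y # zs) ! Suc (Suc i)}" "Suc (Suc i) < length (x # y # zs)"
        using e by auto
      then show ?thesis by blast
    qed
    moreover have "{x, y} \<in> ?A" by force
    ultimately show "?B \<subseteq> ?A" by blast
  qed
  then show ?case using 1 by simp
qed auto

lemma cycle_edges_conv_path_edges:
  assumes "vs \<noteq> []"
  shows "cycle_edges vs = insert {last vs, hd vs} (path_edges vs)"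
proof -
  define l where "l = length vs - 1"
  have l: "length vs = Suc l" using assms by (simp add: l_def)
  have "cycle_edges vs = (\<lambda>i. {vs ! i, vs ! (Suc i mod length vs)}) ` {..<Suc l}"
    unfolding cycle_edges_def l by auto
  also have "{..<Suc l} = insert l {..<l}" by auto
  also have "(\<lambda>i. {vs ! i, vs ! (Suc i mod length vs)}) ` \<dots> =
      insert {vs ! l, vs ! 0} ((\<lambda>i. {vs ! i, vs ! Suc i}) ` {..<l})"
    using l by (auto simp: image_iff)
  also have "(\<lambda>i. {vs ! i, vs ! Suc i}) ` {..<l} = path_edges vs"
    unfolding path_edges_conv_nth using l by auto
  finally show ?thesis using assms l by (simp add: last_conv_nth hd_conv_nth)
qed

lemma cycle_edges_append:
  assumes "xs \<noteq> []" "ys \<noteq> []"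
  shows "cycle_edges (xs @ ys) =
    {{last xs, hd ys}, {last ys, hd xs}} \<union> path_edges xs \<union> path_edges ys"
  using assms by (auto simp: cycle_edges_conv_path_edges path_edges_append)

lemma cycle_edges_swap: "cycle_edges (ys @ xs) = cycle_edges (xs @ ys)"
proof (cases "xs = [] \<or> ys = []")
  case False
  then show ?thesis by (auto simp: cycle_edges_append)
qed auto

lemma cycle_edges_rotate: "cycle_edges (rotate m xs) = cycle_edges xs"
  unfolding rotate_drop_take by (subst cycle_edges_swap) simp

lemma cycle_edges_map: "cycle_edges (map f vs) = (`) f ` cycle_edges vs"
proof -
  have "{map f vs ! i, map f vs ! (Suc i mod length vs)} = f ` {vs ! i, vs ! (Suc i mod length vs)}"
    if "i < length vs" for i
  proof -
    have "Suc i mod length vs < length vs" using that by (intro mod_less_divisor) auto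
    then show ?thesis using that by simp
  qed
  then show ?thesis
    unfolding cycle_edges_def length_map setcompr_eq_image image_image by (intro image_cong) auto
qed

lemma finite_cycle_edges: "finite (cycle_edges vs)"
  unfolding cycle_edges_def by simp

lemma cycle_edges_subset_Pow: "cycle_edges vs \<subseteq> Pow (set vs)"
proof (cases "vs = []")
  case False
  then show ?thesis using path_edges_subset_Pow[of vs] by (auto simp: cycle_edges_conv_path_edges)
qed (simp add: cycle_edges_def)

text \<open>In a distinct list the head occurs only once, so the path after it contains no edge at
  the head; what remains are the first edge and the closing edge. Rooting a cycle at a vertex thus
  turns adjacency to it into a condition on two positions.\<close>

lemma doubleton_hd_in_cycle_edges_iff:
  assumes "distinct vs" "2 \<le> length vs" "w \<noteq> hd vs"
  shows "{hd vs, w} \<in> cycle_edges vs \<longleftrightarrow> w = vs ! 1 \<or> w = last vs"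
proof -
  obtain v x xs where vs: "vs = v # x # xs"
    using assms(2) by (cases vs rule: path_edges.cases) auto
  have "cycle_edges ([v] @ (x # xs)) =
     {{v, x}, {last (x # xs), v}} \<union> path_edges (x # xs)"
    by (subst cycle_edges_append) auto
  moreover have "{v, w} \<notin> path_edges (x # xs)"
    using path_edges_subset_Pow[of "x # xs"] assms(1) vs by auto
  ultimately show ?thesis using vs assms(3) by (auto simp: doubleton_eq_iff)
qed

section \<open>Suffix reversal as a switching\<close>

text \<open>This is the switching in list form. With \<open>v = hd vs\<close>,
  \<open>u = last vs\<close>, \<open>x = vs ! (i - 1)\<close> and \<open>y = vs ! i\<close>,
  reversing the suffix replaces the cycle edges \<open>uv\<close>, \<open>xy\<close> by
  \<open>ux\<close>, \<open>vy\<close>. For fixed \<open>i\<close> it is an involution, so it also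
  describes the inverse switching.\<close>

definition rev_suffix :: "nat \<Rightarrow> 'a list \<Rightarrow> 'a list" where
  "rev_suffix i vs = take i vs @ rev (drop i vs)"

lemma length_rev_suffix [simp]: "length (rev_suffix i vs) = length vs"
  by (simp add: rev_suffix_def)

lemma rev_suffix_rev_suffix [simp]: "i \<le> length vs \<Longrightarrow> rev_suffix i (rev_suffix i vs) = vs"
  by (simp add: rev_suffix_def)

lemma rev_suffix_in_permutations_of_set_iff [simp]:
  "rev_suffix i vs \<in> permutations_of_set V \<longleftrightarrow> vs \<in> permutations_of_set V"
proof -
  have "mset (rev_suffix i vs) = mset vs"
    unfolding rev_suffix_def by (metis append_take_drop_id mset_append mset_rev)
  then have "set (rev_suffix i vs) = set vs" "distinct (rev_suffix i vs) = distinct vs"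
    using mset_eq_setD mset_eq_imp_distinct_iff by blast+
  then show ?thesis by (simp add: permutations_of_set_def)
qed

lemma hd_rev_suffix: "0 < i \<Longrightarrow> i < length vs \<Longrightarrow> hd (rev_suffix i vs) = hd vs"
  by (cases vs; cases i) (auto simp: rev_suffix_def)

lemma last_rev_suffix: "i < length vs \<Longrightarrow> last (rev_suffix i vs) = vs ! i"
  by (simp add: rev_suffix_def last_rev hd_drop_conv_nth)

lemma nth_rev_suffix:
  assumes "i < length vs"
  shows "rev_suffix i vs ! i = last vs"
proof -
  have "rev_suffix i vs ! i = last (drop i vs)"
    using assms by (simp add: rev_suffix_def nth_append min_def hd_rev flip: hd_conv_nth)
  then show ?thesis using assms by simp
qed

lemma nth_rev_suffix_less: "j < i \<Longrightarrow> i < length vs \<Longrightarrow> rev_suffix i vs ! j = vs ! j"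
  by (simp add: rev_suffix_def nth_append)

lemma cycle_edges_split:
  assumes "0 < i" "i < length vs"
  shows "cycle_edges vs = {{vs ! (i - 1), vs ! i}, {last vs, hd vs}} \<union>
     path_edges (take i vs) \<union> path_edges (drop i vs)"
proof -
  have ne: "take i vs \<noteq> []" "drop i vs \<noteq> []" using assms by auto
  have "last (take i vs) = vs ! (i - 1)" using assms ne by (simp add: last_conv_nth min_def)
  then show ?thesis
    using cycle_edges_append[OF ne] assms by (simp add: hd_drop_conv_nth hd_take)
qed

text \<open>A reversed path has the same edges, so applying \<open>cycle_edges_split\<close> to the
  reversed list changes only the two edges that join the prefix to the suffix.\<close>

lemma cycle_edges_rev_suffix:
  assumes "0 < i" "i < length vs"
  shows "cycle_edges (rev_suffix i vs) = {{vs ! (i - 1), last vs}, {vs ! i, hd vs}} \<union>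
     path_edges (take i vs) \<union> path_edges (drop i vs)"
proof -
  have "take i (rev_suffix i vs) = take i vs" "drop i (rev_suffix i vs) = rev (drop i vs)"
    using assms by (auto simp: rev_suffix_def)
  then show ?thesis
    using cycle_edges_split[of i "rev_suffix i vs"] assms
    by (simp add: last_rev_suffix nth_rev_suffix nth_rev_suffix_less hd_rev_suffix path_edges_rev)
qed

section \<open>Counting vertex orders\<close>

text \<open>Both parts of the fraction \<open>q\<close> have this form: \<open>D = {}\<close> gives
  the orders that avoid \<open>F\<close>, and \<open>D = {e}\<close> those among them that use
  \<open>e\<close>.\<close>

definition ham_orders :: "'a set \<Rightarrow> 'a set set \<Rightarrow> 'a set set \<Rightarrow> 'a list set" where
  "ham_orders V F D = {vs \<in> permutations_of_set V. cycle_edges vs \<inter> F = {} \<and> D \<subseteq> cycle_edges vs}"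

lemma ham_ordersD:
  assumes "vs \<in> ham_orders V F D"
  shows "distinct vs" "set vs = V" "length vs = card V"
    "cycle_edges vs \<inter> F = {}" "D \<subseteq> cycle_edges vs"
  using assms by (auto simp: ham_orders_def permutations_of_set_def distinct_card)

lemma finite_ham_orders [simp]: "finite (ham_orders V F D)"
  by (simp add: ham_orders_def)

section \<open>Normalising orders by rotation and reflection\<close>

lemma rotate_in_ham_orders: "vs \<in> ham_orders V F D \<Longrightarrow> rotate i vs \<in> ham_orders V F D"
  by (simp add: ham_orders_def cycle_edges_rotate permutations_of_set_def)

text \<open>Membership depends only on the cycle, which rotation preserves. Rotating by
  \<open>i\<close> brings the vertex at position \<open>i\<close> to the front, so \<open>v\<close>
  occupies each of the \<open>card V\<close> positions equally often. Hence it suffices to count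
  orders rooted at \<open>v\<close>, where suffix reversal applies.\<close>

lemma card_ham_orders_hd:
  assumes "v \<in> V" "finite V"
  shows "card (ham_orders V F D) = card V * card {vs \<in> ham_orders V F D. hd vs = v}"
proof -
  let ?n = "card V" and ?H = "ham_orders V F D"
  have "?H = (\<Union>i\<in>{..<?n}. {vs \<in> ?H. vs ! i = v})"
  proof (intro equalityI subsetI)
    fix vs assume vs: "vs \<in> ?H"
    then have "v \<in> set vs" using assms ham_ordersD(2) by auto
    then obtain i where "i < length vs" "vs ! i = v" by (auto simp: in_set_conv_nth)
    then show "vs \<in> (\<Union>i\<in>{..<?n}. {vs \<in> ?H. vs ! i = v})"
      using vs ham_ordersD(3)[OF vs] by auto
  qed auto
  then have "card ?H = card (\<Union>i\<in>{..<?n}. {vs \<in> ?H. vs ! i = v})" by simp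
  also have "\<dots> = (\<Sum>i<?n. card {vs \<in> ?H. vs ! i = v})"
  proof (rule card_UN_disjoint)
    show "\<forall>i\<in>{..<?n}. \<forall>j\<in>{..<?n}. i \<noteq> j \<longrightarrow> {vs \<in> ?H. vs ! i = v} \<inter> {vs \<in> ?H. vs ! j = v} = {}"
    proof (intro ballI impI equals0I)
      fix i j vs
      assume *: "i \<in> {..<?n}" "j \<in> {..<?n}" "i \<noteq> j" "vs \<in> {vs \<in> ?H. vs ! i = v} \<inter> {vs \<in> ?H. vs ! j = v}"
      then have "vs \<in> ?H" "vs ! i = vs ! j" by auto
      then show False
        using * ham_ordersD(1,3)[of vs V F D] nth_eq_iff_index_eq[of vs i j] by simp
    qed
  qed auto
  also have "\<dots> = (\<Sum>i<?n. card {vs \<in> ?H. hd vs = v})"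
  proof (rule sum.cong [OF refl])
    fix i assume i: "i \<in> {..<?n}"
    have "bij_betw (rotate i) {vs \<in> ?H. vs ! i = v} {vs \<in> ?H. hd vs = v}"
    proof (rule bij_betw_byWitness[where f' = "rotate (?n - i)"])
      have *: "rotate (?n - i) (rotate i vs) = vs" "rotate i (rotate (?n - i) vs) = vs"
        if "vs \<in> ?H" for vs
        using i ham_ordersD(3)[OF that] by (auto simp: rotate_rotate rotate_id)
      show "\<forall>vs\<in>{vs \<in> ?H. vs ! i = v}. rotate (?n - i) (rotate i vs) = vs"
        "\<forall>vs\<in>{vs \<in> ?H. hd vs = v}. rotate i (rotate (?n - i) vs) = vs"
        using * by auto
      have hd: "hd (rotate i vs) = vs ! i" if "vs \<in> ?H" for vs
        using i ham_ordersD(3)[OF that] by (subst hd_rotate_conv_nth) auto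
      show "rotate i ` {vs \<in> ?H. vs ! i = v} \<subseteq> {vs \<in> ?H. hd vs = v}"
        by (auto simp: hd rotate_in_ham_orders)
      have "rotate (?n - i) vs ! i = hd vs" if "vs \<in> ?H" for vs
        using hd[OF rotate_in_ham_orders[OF that, of "?n - i"]] *(2)[OF that] by simp
      then show "rotate (?n - i) ` {vs \<in> ?H. hd vs = v} \<subseteq> {vs \<in> ?H. vs ! i = v}"
        by (auto simp: rotate_in_ham_orders)
    qed
    then show "card {vs \<in> ?H. vs ! i = v} = card {vs \<in> ?H. hd vs = v}"
      by (rule bij_betw_same_card)
  qed
  also have "\<dots> = ?n * card {vs \<in> ?H. hd vs = v}" by simp
  finally show ?thesis .
qed

text \<open>Reversing everything after the first vertex traverses the same cycle in the opposite
  direction. This reflection exchanges the second and the last vertex.\<close>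

lemma rev_suffix_1_in_ham_orders:
  assumes "vs \<in> ham_orders V F D" "2 \<le> card V"
  shows "rev_suffix 1 vs \<in> ham_orders V F D"
proof -
  have len: "1 < length vs" using ham_ordersD(3)[OF assms(1)] assms(2) by simp
  then have "vs ! 0 = hd vs" by (subst hd_conv_nth) auto
  then have "cycle_edges (rev_suffix 1 vs) = cycle_edges vs"
    using cycle_edges_rev_suffix[of 1 vs] cycle_edges_split[of 1 vs] len
    by (auto simp: insert_commute)
  then show ?thesis using assms by (simp add: ham_orders_def)
qed

lemma card_ham_orders_second_eq_last:
  assumes "2 \<le> card V"
  shows "card {vs \<in> ham_orders V F D. hd vs = v \<and> vs ! 1 = u} =
         card {vs \<in> ham_orders V F D. hd vs = v \<and> last vs = u}"
proof (rule bij_betw_same_card [OF bij_betw_byWitness[where f = "rev_suffix 1" and f' = "rev_suffix 1"]])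
  have len: "1 < length vs" if "vs \<in> ham_orders V F D" for vs
    using ham_ordersD(3)[OF that] assms by simp
  show "\<forall>vs\<in>{vs \<in> ham_orders V F D. hd vs = v \<and> vs ! 1 = u}. rev_suffix 1 (rev_suffix 1 vs) = vs"
    "\<forall>vs\<in>{vs \<in> ham_orders V F D. hd vs = v \<and> last vs = u}. rev_suffix 1 (rev_suffix 1 vs) = vs"
    using len by (auto intro!: rev_suffix_rev_suffix less_imp_le simp del: One_nat_def)
  show "rev_suffix 1 ` {vs \<in> ham_orders V F D. hd vs = v \<and> vs ! 1 = u}
      \<subseteq> {vs \<in> ham_orders V F D. hd vs = v \<and> last vs = u}"
    "rev_suffix 1 ` {vs \<in> ham_orders V F D. hd vs = v \<and> last vs = u}
      \<subseteq> {vs \<in> ham_orders V F D. hd vs = v \<and> vs ! 1 = u}"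
    using assms
    by (auto simp: len hd_rev_suffix last_rev_suffix nth_rev_suffix rev_suffix_1_in_ham_orders
        simp del: One_nat_def)
qed

text \<open>From the root \<open>v\<close>, the edge \<open>uv\<close> is traversed either first or
  last. With at least three vertices these cases exclude each other, and the reflection shows that
  they are equally frequent.\<close>

lemma card_ham_orders_edge_hd:
  assumes "u \<noteq> v" "3 \<le> card V"
  shows "card {vs \<in> ham_orders V F {{u, v}}. hd vs = v} =
         2 * card {vs \<in> ham_orders V F {}. hd vs = v \<and> last vs = u}"
proof -
  let ?H = "ham_orders V F {}"
  have "{vs \<in> ham_orders V F {{u, v}}. hd vs = v} =
      {vs \<in> ?H. hd vs = v \<and> vs ! 1 = u} \<union> {vs \<in> ?H. hd vs = v \<and> last vs = u}"
  proof -
    have "{u, v} \<in> cycle_edges vs \<longleftrightarrow> u = vs ! 1 \<or> u = last vs" if "vs \<in> ?H" "hd vs = v" for vs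
      using doubleton_hd_in_cycle_edges_iff[of vs u] ham_ordersD[OF that(1)] assms that(2)
      by (simp add: insert_commute)
    then show ?thesis by (auto simp: ham_orders_def)
  qed
  moreover have "{vs \<in> ?H. hd vs = v \<and> vs ! 1 = u} \<inter> {vs \<in> ?H. hd vs = v \<and> last vs = u} = {}"
  proof -
    have "vs ! 1 \<noteq> last vs" if "vs \<in> ?H" for vs
      using ham_ordersD(1,3)[OF that] assms(2)
      by (subst last_conv_nth) (auto simp: nth_eq_iff_index_eq)
    then show ?thesis by fastforce
  qed
  ultimately have "card {vs \<in> ham_orders V F {{u, v}}. hd vs = v} =
      card {vs \<in> ?H. hd vs = v \<and> vs ! 1 = u} + card {vs \<in> ?H. hd vs = v \<and> last vs = u}"
    by (simp add: card_Un_disjoint)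
  then show ?thesis
    using card_ham_orders_second_eq_last[of V F "{}" v u] assms by simp
qed

section \<open>Counting switchings in both directions\<close>

text \<open>The reversed position is recovered as the place where the old last vertex \<open>u\<close> ends up.\<close>

lemma inj_on_Sigma_rev_suffix:
  assumes "\<And>vs. vs \<in> A \<Longrightarrow> distinct vs \<and> length vs = n \<and> last vs = u" "\<And>vs. I vs \<subseteq> {..<n}"
  shows "inj_on (\<lambda>(vs, i). rev_suffix i vs) (Sigma A I)"
proof (rule inj_onI, clarify)
  fix vs i ws j
  assume *: "vs \<in> A" "i \<in> I vs" "ws \<in> A" "j \<in> I ws" "rev_suffix i vs = rev_suffix j ws"
  have vs: "distinct vs" "length vs = n" "last vs = u" and ws: "length ws = n" "last ws = u"
    and ij: "i < n" "j < n"
    using assms(1)[OF *(1)] assms(1)[OF *(3)] subsetD[OF assms(2) *(2)] subsetD[OF assms(2) *(4)]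
    by auto
  have "distinct (rev_suffix i vs)"
    using rev_suffix_in_permutations_of_set_iff[of i vs "set vs"] vs
    by (simp add: permutations_of_set_def)
  moreover have "rev_suffix i vs ! i = rev_suffix i vs ! j"
    using nth_rev_suffix[of i vs] nth_rev_suffix[of j ws] *(5) vs ws ij by simp
  ultimately have "i = j" using vs ij by (simp add: nth_eq_iff_index_eq)
  then show "vs = ws \<and> i = j"
    using *(5) rev_suffix_rev_suffix[of i vs] rev_suffix_rev_suffix[of i ws] vs(2) ws(1) ij(1)
    by (metis less_imp_le)
qed

text \<open>Count pairs of an order ending in \<open>u\<close> and a cut \<open>i\<close> whose
  switching stays in \<open>ham_orders V F D\<close>. Of the \<open>card V - 3\<close> cuts, at most
  \<open>d\<close> create an edge of \<open>F\<close> at \<open>u\<close>, at most \<open>d\<close>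
  create one at \<open>v\<close>, and at most \<open>card D\<close> destroy an edge of
  \<open>D\<close>; the other destroyed edge \<open>uv\<close> is not in \<open>D\<close>. Different
  pairs give different results by \<open>inj_on_Sigma_rev_suffix\<close>.\<close>

lemma card_ham_orders_last_le:
  assumes fin: "finite V" "finite D" and uv: "u \<in> V" "v \<in> V" "{u, v} \<notin> D"
    and deg: "\<And>x. x \<in> V \<Longrightarrow> card {y \<in> V. {x, y} \<in> F} \<le> d"
    and n: "3 + 2 * d + card D \<le> card V"
  shows "card {vs \<in> ham_orders V F D. hd vs = v \<and> last vs = u} * (card V - 3 - 2 * d - card D)
      \<le> card {vs \<in> ham_orders V F D. hd vs = v}"
proof -
  let ?n = "card V" and ?H = "ham_orders V F D"
  define A where "A = {vs \<in> ?H. hd vs = v \<and> last vs = u}"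
  \<comment> \<open>Cut 1 would only reverse the direction of the cycle, and cut
    \<open>card V - 1\<close> would reverse a single vertex; both are left out.\<close>
  define I where "I vs = {i \<in> {2..?n - 2}. rev_suffix i vs \<in> ?H}" for vs
  have A: "vs \<in> ?H" "distinct vs" "set vs = V" "length vs = ?n" "hd vs = v" "last vs = u"
    if "vs \<in> A" for vs
    using that ham_ordersD(1-3)[of vs V F D] unfolding A_def by auto
  have I: "?n - 3 - 2 * d - card D \<le> card (I vs)" if vs: "vs \<in> A" for vs
  proof -
    define B1 where "B1 = {i \<in> {2..?n - 2}. {u, vs ! (i - 1)} \<in> F}"
    define B2 where "B2 = {i \<in> {2..?n - 2}. {v, vs ! i} \<in> F}"
    define B3 where "B3 = {i \<in> {2..?n - 2}. {vs ! (i - 1), vs ! i} \<in> D}"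
    note vs' = A[OF vs]
    have nth_V: "vs ! i \<in> V" if "i < ?n" for i using vs'(3,4) that nth_mem[of i vs] by simp
    have nth_eq: "vs ! i = vs ! j \<longleftrightarrow> i = j" if "i < ?n" "j < ?n" for i j
      using vs' that by (simp add: nth_eq_iff_index_eq)
    have "card B1 \<le> card {y \<in> V. {u, y} \<in> F}"
      by (rule card_inj_on_le[where f = "\<lambda>i. vs ! (i - 1)"])
        (use fin nth_V in \<open>auto simp: B1_def inj_on_def nth_eq\<close>)
    then have B1: "card B1 \<le> d" using deg[OF uv(1)] by linarith
    have "card B2 \<le> card {y \<in> V. {v, y} \<in> F}"
      by (rule card_inj_on_le[where f = "\<lambda>i. vs ! i"])
        (use fin nth_V in \<open>auto simp: B2_def inj_on_def nth_eq\<close>)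
    then have B2: "card B2 \<le> d" using deg[OF uv(2)] by linarith
    have B3: "card B3 \<le> card D"
    proof (rule card_inj_on_le[where f = "\<lambda>i. {vs ! (i - 1), vs ! i}"])
      show "inj_on (\<lambda>i. {vs ! (i - 1), vs ! i}) B3"
      proof (rule inj_onI)
        fix i j assume *: "i \<in> B3" "j \<in> B3" "{vs ! (i - 1), vs ! i} = {vs ! (j - 1), vs ! j}"
        then have "2 \<le> i" "2 \<le> j" "i < ?n" "j < ?n" by (auto simp: B3_def)
        then show "i = j"
          using *(3) nth_eq[of i j] nth_eq[of i "j - 1"] nth_eq[of "i - 1" j]
          by (auto simp: doubleton_eq_iff)
      qed
    qed (use fin in \<open>auto simp: B3_def\<close>)
    have "{2..?n - 2} \<subseteq> I vs \<union> (B1 \<union> B2 \<union> B3)"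
    proof
      fix i assume i: "i \<in> {2..?n - 2}"
      then have i': "0 < i" "i < length vs" using vs' by auto
      show "i \<in> I vs \<union> (B1 \<union> B2 \<union> B3)"
      proof (cases "i \<in> B1 \<union> B2 \<union> B3")
        case False
        then have *: "{u, vs ! (i - 1)} \<notin> F" "{v, vs ! i} \<notin> F" "{vs ! (i - 1), vs ! i} \<notin> D"
          using i by (auto simp: B1_def B2_def B3_def)
        have "cycle_edges (rev_suffix i vs) \<inter> F = {}" "D \<subseteq> cycle_edges (rev_suffix i vs)"
          using ham_ordersD(4,5)[OF vs'(1)] * uv(3) vs'(5,6)
          unfolding cycle_edges_split[OF i'] cycle_edges_rev_suffix[OF i']
          by (auto simp: insert_commute)
        then have "rev_suffix i vs \<in> ?H" using vs'(1) by (simp add: ham_orders_def)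
        then show ?thesis using i by (simp add: I_def)
      qed auto
    qed
    then have "card {2..?n - 2} \<le> card (I vs \<union> (B1 \<union> B2 \<union> B3))"
      by (intro card_mono) (auto simp: I_def B1_def B2_def B3_def)
    also have "\<dots> \<le> card (I vs) + (card B1 + card B2 + card B3)"
      using card_Un_le[of "I vs" "B1 \<union> B2 \<union> B3"] card_Un_le[of "B1 \<union> B2" B3] card_Un_le[of B1 B2]
      by linarith
    finally show ?thesis using B1 B2 B3 by simp
  qed
  have fin': "finite A" "finite (I vs)" for vs by (auto simp: A_def I_def)
  have "card A * (?n - 3 - 2 * d - card D) \<le> (\<Sum>vs\<in>A. card (I vs))"
    using sum_mono[of A "\<lambda>_. ?n - 3 - 2 * d - card D" "\<lambda>vs. card (I vs)"] I by simp
  also have "\<dots> = card (Sigma A I)" using fin' by (simp add: card_SigmaI)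
  also have "\<dots> \<le> card {vs \<in> ?H. hd vs = v}"
  proof (rule card_inj_on_le[where f = "\<lambda>(vs, i). rev_suffix i vs"])
    have "I vs \<subseteq> {..<?n}" for vs using n by (auto simp: I_def)
    then show "inj_on (\<lambda>(vs, i). rev_suffix i vs) (Sigma A I)"
      using A by (intro inj_on_Sigma_rev_suffix[where n = ?n and u = u]) auto
    show "(\<lambda>(vs, i). rev_suffix i vs) ` Sigma A I \<subseteq> {vs \<in> ?H. hd vs = v}"
      using A by (auto simp: I_def hd_rev_suffix)
  qed auto
  finally show ?thesis by (simp add: A_def)
qed

text \<open>The case \<open>D = {}\<close> of the switching bound, summed over the positions of
  \<open>v\<close>; the factor 2 stands for the two directions in which \<open>uv\<close> is
  traversed. It is the upper bound \<open>2 / (card V - 3 - 2 * d)\<close> for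
  \<open>q\<close>.\<close>

lemma card_ham_orders_edge_le:
  assumes fin: "finite V" and uv: "u \<in> V" "v \<in> V" "u \<noteq> v"
    and deg: "\<And>x. x \<in> V \<Longrightarrow> card {y \<in> V. {x, y} \<in> F} \<le> d"
    and n: "3 + 2 * d \<le> card V"
  shows "card (ham_orders V F {{u, v}}) * (card V - 3 - 2 * d) \<le> 2 * card (ham_orders V F {})"
proof -
  let ?a = "card {vs \<in> ham_orders V F {}. hd vs = v \<and> last vs = u}"
  have "?a * (card V - 3 - 2 * d) \<le> card {vs \<in> ham_orders V F {}. hd vs = v}"
    using card_ham_orders_last_le[of V "{}" u v F d] assms by simp
  moreover have "card (ham_orders V F {{u, v}}) = card V * (2 * ?a)"
    using card_ham_orders_hd[of v V F "{{u, v}}"] card_ham_orders_edge_hd[of u v V F] assms by simp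
  moreover have "card (ham_orders V F {}) = card V * card {vs \<in> ham_orders V F {}. hd vs = v}"
    using card_ham_orders_hd[of v V F "{}"] assms by simp
  ultimately show ?thesis by simp
qed

text \<open>The orders with no preimage under the switching towards \<open>last vs = u\<close>: such an order contains the
  two edges \<open>{x, u}\<close> and \<open>{y, v}\<close> for one of the at most \<open>n d\<close> pairs with \<open>{x, y} \<in> F\<close>.\<close>

lemma card_blocked_orders_le:
  fixes u v :: 'a
  assumes fin: "finite V" and uv: "u \<in> V" "v \<in> V" "u \<noteq> v"
    and deg: "\<And>x. x \<in> V \<Longrightarrow> card {y \<in> V. {x, y} \<in> F} \<le> d"
    and n: "4 + 2 * d \<le> card V"
  defines "B \<equiv> {vs \<in> ham_orders V F {}. hd vs = v \<and>
      (\<exists>i\<in>{2..card V - 2}. vs ! i = u \<and> {vs ! (i - 1), last vs} \<in> F)}"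
  shows "card B * ((card V - 4 - 2 * d) * (card V - 3 - 2 * d)) \<le> 2 * d * card (ham_orders V F {})"
proof -
  let ?n = "card V" and ?N = "card (ham_orders V F {})"
  define m where "m = (?n - 4 - 2 * d) * (?n - 3 - 2 * d)"
  \<comment> \<open>A pair \<open>(y, x)\<close> records the last vertex and the predecessor of
    \<open>u\<close>.\<close>
  define P where "P = (SIGMA y:V - {u}. {x \<in> V - {u}. {y, x} \<in> F})"
  define T where "T = (\<lambda>(y, x). {vs \<in> ham_orders V F {{x, u}}. hd vs = v \<and> last vs = y})"
  have finP: "finite P" using fin by (auto simp: P_def)
  have "card P = (\<Sum>y\<in>V - {u}. card {x \<in> V - {u}. {y, x} \<in> F})"
    unfolding P_def using fin by (subst card_SigmaI) auto
  also have "\<dots> \<le> (\<Sum>y\<in>V - {u}. d)"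
  proof (rule sum_mono)
    fix y assume "y \<in> V - {u}"
    then have "card {x \<in> V. {y, x} \<in> F} \<le> d" using deg by simp
    moreover have "card {x \<in> V - {u}. {y, x} \<in> F} \<le> card {x \<in> V. {y, x} \<in> F}"
      using fin by (intro card_mono) auto
    ultimately show "card {x \<in> V - {u}. {y, x} \<in> F} \<le> d" by simp
  qed
  also have "\<dots> \<le> ?n * d" using fin by (simp add: card_Diff_singleton_if)
  finally have cardP: "card P \<le> ?n * d" .
  \<comment> \<open>For a fixed pair the two edges are treated in turn: the switching at the closing
    edge \<open>yv\<close> must keep the edge \<open>xu\<close>, which costs the extra 1 in
    \<open>card V - 4 - 2 * d\<close>; then the edge bound is applied to \<open>xu\<close>
    itself.\<close>
  have T: "?n * (card (T p) * m) \<le> 2 * ?N" if p: "p \<in> P" for p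
  proof -
    obtain y x where xy: "p = (y, x)" "y \<in> V" "y \<noteq> u" "x \<in> V" "x \<noteq> u"
      using p by (auto simp: P_def)
    have "{y, v} \<notin> {{x, u}}" using xy uv by (auto simp: doubleton_eq_iff)
    then have 1: "card (T p) * (?n - 4 - 2 * d) \<le> card {vs \<in> ham_orders V F {{x, u}}. hd vs = v}"
      using card_ham_orders_last_le[of V "{{x, u}}" y v F d] fin uv xy deg n by (simp add: T_def)
    have 2: "?n * card {vs \<in> ham_orders V F {{x, u}}. hd vs = v} = card (ham_orders V F {{x, u}})"
      using card_ham_orders_hd[of v V] uv fin by simp
    have 3: "card (ham_orders V F {{x, u}}) * (?n - 3 - 2 * d) \<le> 2 * ?N"
      using card_ham_orders_edge_le[of V x u F d] fin uv xy deg n by simp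
    have "?n * (card (T p) * m) = ?n * (card (T p) * (?n - 4 - 2 * d)) * (?n - 3 - 2 * d)"
      by (simp add: m_def)
    also have "\<dots> \<le> ?n * card {vs \<in> ham_orders V F {{x, u}}. hd vs = v} * (?n - 3 - 2 * d)"
      using 1 by (intro mult_le_mono) auto
    finally show ?thesis using 2 3 by simp
  qed
  have "B \<subseteq> (\<Union>p\<in>P. T p)"
  proof
    fix vs assume "vs \<in> B"
    then obtain i where vs: "vs \<in> ham_orders V F {}" "hd vs = v"
      and i: "i \<in> {2..?n - 2}" "vs ! i = u" "{vs ! (i - 1), last vs} \<in> F"
      by (auto simp: B_def)
    note vs' = ham_ordersD[OF vs(1)]
    have i': "0 < i" "i < length vs" "i - 1 < length vs" "?n - 1 < length vs" "i \<noteq> ?n - 1"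
      using i vs'(3) n by auto
    have last: "last vs = vs ! (?n - 1)" using i' vs'(3) by (subst last_conv_nth) auto
    have "last vs \<noteq> u" "vs ! (i - 1) \<noteq> u"
      unfolding last i(2)[symmetric] using i' vs'(1) by (auto simp: nth_eq_iff_index_eq)
    moreover have "last vs \<in> V" "vs ! (i - 1) \<in> V"
      unfolding last using i' vs'(2) nth_mem by blast+
    ultimately have "(last vs, vs ! (i - 1)) \<in> P" using i by (simp add: P_def insert_commute)
    moreover have "{vs ! (i - 1), u} \<in> cycle_edges vs"
      unfolding cycle_edges_split[OF i'(1,2)] i(2) by simp
    then have "vs \<in> T (last vs, vs ! (i - 1))"
      using vs by (simp add: T_def ham_orders_def)
    ultimately show "vs \<in> (\<Union>p\<in>P. T p)" by blast
  qed
  then have "card B \<le> card (\<Union>p\<in>P. T p)"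
    using finP by (intro card_mono) (auto simp: T_def)
  also have "\<dots> \<le> (\<Sum>p\<in>P. card (T p))" by (rule card_UN_le [OF finP])
  finally have "?n * (card B * m) \<le> ?n * ((\<Sum>p\<in>P. card (T p)) * m)" by simp
  also have "\<dots> = (\<Sum>p\<in>P. ?n * (card (T p) * m))"
    by (simp add: sum_distrib_left sum_distrib_right)
  also have "\<dots> \<le> (\<Sum>p\<in>P. 2 * ?N)" by (rule sum_mono) (rule T)
  also have "\<dots> \<le> ?n * d * (2 * ?N)" using cardP by (simp add: mult_le_mono1)
  finally have "?n * (card B * m) \<le> ?n * (2 * d * ?N)" by (simp add: mult_ac)
  then show ?thesis using n by (simp add: m_def)
qed

text \<open>The switching read backwards. In an order rooted at \<open>v\<close>, the vertex
  \<open>u\<close> stands second, last, or at a position \<open>i\<close> in between. In the last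
  case the reversal at \<open>i\<close> moves \<open>u\<close> to the end and restores the edges
  \<open>uv\<close> and \<open>{vs ! (i - 1), last vs}\<close>; it fails only if the latter lies in
  \<open>F\<close>. The unblocked orders number at most \<open>1 + 1 + (card V - 3)\<close> times
  the orders ending in \<open>u\<close>.\<close>

lemma card_ham_orders_hd_le:
  assumes fin: "finite V" and uv: "u \<in> V" "v \<in> V" "u \<noteq> v" "{u, v} \<notin> F" and n: "4 \<le> card V"
  shows "card {vs \<in> ham_orders V F {}. hd vs = v} \<le>
     card {vs \<in> ham_orders V F {}. hd vs = v \<and> last vs = u} * (card V - 1) +
     card {vs \<in> ham_orders V F {}. hd vs = v \<and>
      (\<exists>i\<in>{2..card V - 2}. vs ! i = u \<and> {vs ! (i - 1), last vs} \<in> F)}"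
    (is "card ?S \<le> card ?A * _ + card ?B")
proof -
  let ?n = "card V" and ?H = "ham_orders V F {}"
  let ?A1 = "{vs \<in> ?H. hd vs = v \<and> vs ! 1 = u}"
  let ?R = "(\<lambda>(vs, i). rev_suffix i vs) ` (?A \<times> {2..?n - 2})"
  have "?S \<subseteq> ?A \<union> ?A1 \<union> ?R \<union> ?B"
  proof
    fix vs assume "vs \<in> ?S"
    then have vs: "vs \<in> ?H" "hd vs = v" by auto
    note vs' = ham_ordersD[OF vs(1)]
    obtain i where i: "i < ?n" "vs ! i = u"
      using uv(1) vs'(2,3) by (metis in_set_conv_nth)
    have hd: "vs ! 0 = v" using vs vs'(3) n by (subst (asm) hd_conv_nth) auto
    then have "i \<noteq> 0" using i uv(3) by metis
    then consider "i = 1" | "i = ?n - 1" | "i \<in> {2..?n - 2}" using i(1) by fastforce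
    then show "vs \<in> ?A \<union> ?A1 \<union> ?R \<union> ?B"
    proof cases
      case 1
      then show ?thesis using vs i by auto
    next
      case 2
      then have "last vs = u" using vs'(3) i n by (subst last_conv_nth) auto
      then show ?thesis using vs by auto
    next
      case 3
      then have i': "0 < i" "i < length vs" using vs'(3) i by auto
      show ?thesis
      proof (cases "{vs ! (i - 1), last vs} \<in> F")
        case True
        then show ?thesis using vs i 3 by auto
      next
        case False
        have "cycle_edges (rev_suffix i vs) \<inter> F = {}"
          using vs'(4) False uv(4) i(2) vs(2)
          unfolding cycle_edges_split[OF i'] cycle_edges_rev_suffix[OF i'] by auto
        then have "rev_suffix i vs \<in> ?A"
          using vs i i' by (simp add: ham_orders_def hd_rev_suffix last_rev_suffix)
        moreover have "vs = rev_suffix i (rev_suffix i vs)"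
          using i' by simp
        ultimately have "vs \<in> ?R" using 3 by (metis (no_types, lifting) SigmaI case_prod_conv image_eqI)
        then show ?thesis by blast
      qed
    qed
  qed
  then have "card ?S \<le> card (?A \<union> ?A1 \<union> ?R \<union> ?B)" by (intro card_mono) auto
  also have "\<dots> \<le> card ?A + card ?A1 + card ?R + card ?B"
    using card_Un_le[of "?A \<union> ?A1 \<union> ?R" ?B] card_Un_le[of "?A \<union> ?A1" ?R] card_Un_le[of ?A ?A1]
    by linarith
  also have "card ?A1 = card ?A" using card_ham_orders_second_eq_last[of V F "{}" v u] n by simp
  also have "card ?R \<le> card (?A \<times> {2..?n - 2})" by (rule card_image_le) simp
  also have "card (?A \<times> {2..?n - 2}) = card ?A * (?n - 3)" by (simp add: card_cartesian_product)
  also have "card ?A + card ?A + card ?A * (?n - 3) = card ?A * (?n - 1)"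
  proof -
    have "?n - 1 = 2 + (?n - 3)" using n by simp
    then show ?thesis by (simp only: distrib_left)
  qed
  finally show ?thesis by simp
qed

text \<open>The upper bound is \<open>card_ham_orders_edge_le\<close>; the lower bound combines
  \<open>card_ham_orders_hd_le\<close> with \<open>card_blocked_orders_le\<close>. The hypothesis
  \<open>8 + 4 * d\<close> on the size says that \<open>card V - 4 - 2 * d\<close> is at least
  \<open>n / 2\<close>. The errors are \<open>12 + 8 * d\<close> above and \<open>16 * d\<close>
  below, in units of \<open>N / n^2\<close>, and \<open>20 * (d + 1)\<close> covers both.\<close>

lemma card_ham_orders_edge_approx:
  fixes F :: "'a set set"
  assumes fin: "finite V" and uv: "u \<in> V" "v \<in> V" "u \<noteq> v" "{u, v} \<notin> F"
    and deg: "\<And>x. x \<in> V \<Longrightarrow> card {y \<in> V. {x, y} \<in> F} \<le> d"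
    and n: "8 + 4 * d \<le> card V"
  defines "n \<equiv> real (card V)" and "N \<equiv> real (card (ham_orders V F {}))"
  shows "\<bar>real (card (ham_orders V F {{u, v}})) - 2 / n * N\<bar> \<le> 20 * (real d + 1) / n\<^sup>2 * N"
proof -
  define M where "M = real (card (ham_orders V F {{u, v}}))"
  define m where "m = n - 3 - 2 * real d"
  have n0: "n > 0" "N \<ge> 0" "M \<ge> 0" using n by (auto simp: n_def N_def M_def)
  have m: "m = real (card V - 3 - 2 * d)" "m - 1 = real (card V - 4 - 2 * d)"
    using n by (auto simp: m_def n_def of_nat_diff)
  have m2: "m - 1 \<ge> n / 2" using n by (simp add: m_def n_def)
  then have m0: "m \<ge> n / 2" "m > 0" using n0 by auto
  have "M * m = real (card (ham_orders V F {{u, v}}) * (card V - 3 - 2 * d))"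
    unfolding M_def m by simp
  also have "\<dots> \<le> real (2 * card (ham_orders V F {}))"
    using card_ham_orders_edge_le[OF fin uv(1-3) deg] n by (subst of_nat_le_iff) simp
  finally have "M * m \<le> 2 * N" by (simp add: N_def)
  then have "M \<le> 2 * N / m" using m0 by (simp add: field_simps)
  also have "2 / m \<le> 2 / n + 20 * (real d + 1) / n\<^sup>2"
  proof -
    have "2 / m = 2 / n + 2 * (3 + 2 * real d) / (n * m)"
      using n0 m0 by (simp add: field_simps) (simp add: m_def algebra_simps)
    also have "2 * (3 + 2 * real d) / (n * m) \<le> 2 * (3 + 2 * real d) / (n * (n / 2))"
      using n0 m0 by (intro divide_left_mono mult_left_mono mult_pos_pos) auto
    also have "\<dots> = (12 + 8 * real d) / n\<^sup>2"
      using n0 by (simp add: field_simps power2_eq_square)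
    also have "\<dots> \<le> 20 * (real d + 1) / n\<^sup>2"
      by (intro divide_right_mono) auto
    finally show ?thesis by simp
  qed
  then have "2 * N / m \<le> (2 / n + 20 * (real d + 1) / n\<^sup>2) * N"
    using mult_right_mono[OF _ n0(2)] by fastforce
  finally have upper: "M \<le> 2 / n * N + 20 * (real d + 1) / n\<^sup>2 * N"
    by (simp add: distrib_right)

  \<comment> \<open>For the lower bound, rooting at \<open>v\<close> gives \<open>N = n * s\<close>
    and \<open>M = 2 * n * a\<close>, so the backward count becomes
    \<open>N <= n / 2 * M + n * c\<close>. It remains to bound the blocked orders \<open>c\<close>
    by \<open>8 * d / n^2 * N\<close>.\<close>
  define a s c where "a = real (card {vs \<in> ham_orders V F {}. hd vs = v \<and> last vs = u})"
    and "s = real (card {vs \<in> ham_orders V F {}. hd vs = v})"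
    and "c = real (card {vs \<in> ham_orders V F {}. hd vs = v \<and>
      (\<exists>i\<in>{2..card V - 2}. vs ! i = u \<and> {vs ! (i - 1), last vs} \<in> F)})"
  have ac: "a \<ge> 0" "c \<ge> 0" by (auto simp: a_def c_def)
  have "N = n * s"
    unfolding N_def n_def s_def
    using card_ham_orders_hd[of v V F "{}"] uv fin by simp
  have "M = n * (2 * a)"
    unfolding M_def n_def a_def
    using card_ham_orders_hd[of v V F "{{u, v}}"] card_ham_orders_edge_hd[of u v V F] uv fin n by simp
  have "s \<le> a * real (card V - 1) + c"
    unfolding s_def a_def c_def of_nat_mult[symmetric] of_nat_add[symmetric] of_nat_le_iff
    using card_ham_orders_hd_le[OF fin uv] n by simp
  also have "\<dots> \<le> a * n + c" using ac by (intro add_mono mult_left_mono) (auto simp: n_def)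
  finally have s_le: "s \<le> a * n + c" .
  have "c * (n / 2 * (n / 2)) \<le> c * ((m - 1) * m)"
    using m0 m2 ac n0 by (intro mult_left_mono mult_mono) auto
  also have "\<dots> \<le> 2 * real d * N"
  proof -
    have "real (card {vs \<in> ham_orders V F {}. hd vs = v \<and>
      (\<exists>i\<in>{2..card V - 2}. vs ! i = u \<and> {vs ! (i - 1), last vs} \<in> F)} *
       ((card V - 4 - 2 * d) * (card V - 3 - 2 * d))) \<le> real (2 * d * card (ham_orders V F {}))"
      using card_blocked_orders_le[OF fin uv(1-3) deg] n by (subst of_nat_le_iff) simp
    then show ?thesis unfolding c_def N_def m(2) unfolding m(1) by simp
  qed
  finally have c_le: "c \<le> 8 * real d / n\<^sup>2 * N"
    using n0 by (simp add: field_simps power2_eq_square)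
  have "N = n * s" by fact
  also have "\<dots> \<le> n * (a * n + c)" using s_le n0 by (intro mult_left_mono) auto
  also have "\<dots> = n / 2 * M + n * c" using \<open>M = n * (2 * a)\<close> by (simp add: algebra_simps)
  also have "n * c \<le> n * (8 * real d / n\<^sup>2 * N)" using c_le n0 by (intro mult_left_mono) auto
  finally have "N \<le> n / 2 * M + n * (8 * real d / n\<^sup>2 * N)" by simp
  from mult_left_mono[OF this, of "2 / n"]
  have "2 / n * N \<le> 2 / n * (n / 2 * M + n * (8 * real d / n\<^sup>2 * N))" using n0 by simp
  also have "\<dots> = M + 16 * real d / n\<^sup>2 * N" using n0 by (simp add: field_simps)
  also have "16 * real d / n\<^sup>2 * N \<le> 20 * (real d + 1) / n\<^sup>2 * N"
    using n0 by (intro mult_right_mono divide_right_mono) auto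
  finally have "2 / n * N - 20 * (real d + 1) / n\<^sup>2 * N \<le> M" by simp
  with upper show ?thesis unfolding M_def by (simp add: abs_le_iff)
qed

section \<open>Forbidding the edges of a graph one at a time\<close>

lemma ham_orders_insert:
  "ham_orders V (insert e F) {} = ham_orders V F {} - ham_orders V F {e}"
  by (auto simp: ham_orders_def)

lemma ham_orders_mono: "D \<subseteq> D' \<Longrightarrow> ham_orders V F D' \<subseteq> ham_orders V F D"
  by (auto simp: ham_orders_def)

text \<open>The logarithm turns the product of the factors \<open>1 - q\<close> into a sum. Each
  edge contributes \<open>- 2 / n\<close> with an error of at most
  \<open>120 * (d + 1) / n^2\<close>: 20 parts come from the estimate of \<open>q\<close>, and 100
  from linearising \<open>ln (1 - q)\<close>. Positivity is carried along because \<open>q\<close>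
  is a quotient by the current count.\<close>

lemma ln_card_ham_orders:
  assumes "finite F" and fin: "finite V" and F: "F \<subseteq> {e. e \<subseteq> V \<and> card e = 2}"
    and deg: "\<And>x. x \<in> V \<Longrightarrow> card {y \<in> V. {x, y} \<in> F} \<le> d"
    and n: "16 + 4 * d \<le> card V"
  defines "n \<equiv> real (card V)" and "\<Phi> \<equiv> \<lambda>F. real (card (ham_orders V F {}))"
  shows "\<Phi> F > 0 \<and> \<bar>ln (\<Phi> F / fact (card V)) + 2 * real (card F) / n\<bar> \<le> 120 * (real d + 1) * card F / n\<^sup>2"
  using assms(1) F deg
proof (induction F rule: finite_induct)
  case empty
  have "ham_orders V {} {} = permutations_of_set V" by (auto simp: ham_orders_def)
  then have "\<Phi> {} = fact (card V)" using fin by (simp add: \<Phi>_def)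
  then show ?case by simp
next
  case (insert e F)
  have n16: "n \<ge> 16" "n > 0" "4 * (real d + 1) \<le> n" using n by (auto simp: n_def)
  have deg: "card {y \<in> V. {x, y} \<in> F} \<le> d" if "x \<in> V" for x
  proof -
    have "card {y \<in> V. {x, y} \<in> F} \<le> card {y \<in> V. {x, y} \<in> insert e F}"
      using fin by (intro card_mono) auto
    then show ?thesis using insert.prems(2)[OF that] by linarith
  qed
  then have IH: "\<Phi> F > 0" "\<bar>ln (\<Phi> F / fact (card V)) + 2 * real (card F) / n\<bar> \<le> 120 * (real d + 1) * card F / n\<^sup>2"
    using insert by auto
  obtain u v where e: "e = {u, v}" "u \<noteq> v" "u \<in> V" "v \<in> V"
    using insert.prems(1) by (auto simp: card_2_iff)
  define q where "q = real (card (ham_orders V F {e})) / \<Phi> F"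
  define \<delta> where "\<delta> = 20 * (real d + 1) / n\<^sup>2"
  have "\<bar>real (card (ham_orders V F {{u, v}})) - 2 / n * \<Phi> F\<bar> \<le> \<delta> * \<Phi> F"
    unfolding n_def \<Phi>_def \<delta>_def
    using e insert.hyps deg n by (intro card_ham_orders_edge_approx fin) auto
  moreover have "real (card (ham_orders V F {{u, v}})) - 2 / n * \<Phi> F = (q - 2 / n) * \<Phi> F"
    using IH(1) by (simp add: q_def e left_diff_distrib)
  ultimately have "\<bar>q - 2 / n\<bar> * \<Phi> F \<le> \<delta> * \<Phi> F"
    using IH(1) by (simp add: abs_mult)
  then have q: "\<bar>q - 2 / n\<bar> \<le> \<delta>" using IH(1) by simp
  \<comment> \<open>The size hypothesis gives \<open>4 * (d + 1) <= n\<close>, hence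
    \<open>q <= 2 / n + 5 / n\<close>; this is at most 1/2 since \<open>n >= 16\<close>.\<close>
  have "\<delta> \<le> 5 * n / n\<^sup>2"
    unfolding \<delta>_def using n16 by (intro divide_right_mono) auto
  then have "\<delta> \<le> 5 / n" using n16 by (simp add: power2_eq_square)
  then have "q \<le> 7 / n" using q by (simp add: add_divide_distrib[symmetric] abs_le_iff)
  have "q \<ge> 0" by (simp add: q_def \<Phi>_def)
  have "7 / n \<le> 1 / 2" using n16 by (simp add: field_simps)
  then have q_half: "q \<le> 1 / 2" using \<open>q \<le> 7 / n\<close> by linarith
  \<comment> \<open>The quadratic remainder is at most
    \<open>2 * (7 / n)^2 = 98 / n^2\<close>.\<close>
  have "\<bar>ln (1 + (-q)) - (-q)\<bar> \<le> 2 * (-q)\<^sup>2"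
    using q_half \<open>q \<ge> 0\<close> by (intro abs_ln_one_plus_x_minus_x_bound) auto
  also have "2 * (-q)\<^sup>2 \<le> 2 * (7 / n)\<^sup>2" using \<open>q \<le> 7 / n\<close> \<open>q \<ge> 0\<close> by (simp add: power_mono)
  also have "\<dots> \<le> 100 * (real d + 1) / n\<^sup>2"
    unfolding power_divide times_divide_eq_right by (intro divide_right_mono) auto
  finally have "\<bar>ln (1 - q) + q\<bar> \<le> 100 * (real d + 1) / n\<^sup>2" by simp
  with q have ln_q: "\<bar>ln (1 - q) + 2 / n\<bar> \<le> 100 * (real d + 1) / n\<^sup>2 + \<delta>" by linarith
  also have "\<dots> = 120 * (real d + 1) / n\<^sup>2" by (simp add: \<delta>_def add_divide_distrib[symmetric])
  finally have ln_q: "\<bar>ln (1 - q) + 2 / n\<bar> \<le> 120 * (real d + 1) / n\<^sup>2" .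
  have sub: "ham_orders V F {e} \<subseteq> ham_orders V F {}" by (rule ham_orders_mono) simp
  then have "card (ham_orders V F {e}) \<le> card (ham_orders V F {})" by (intro card_mono) auto
  then have "\<Phi> (insert e F) = \<Phi> F - real (card (ham_orders V F {e}))"
    using sub by (simp add: \<Phi>_def ham_orders_insert card_Diff_subset of_nat_diff)
  then have \<Phi>: "\<Phi> (insert e F) = \<Phi> F * (1 - q)"
    using IH(1) by (simp add: q_def right_diff_distrib)
  have pos: "\<Phi> F / fact (card V) > 0" "1 - q > 0" using IH(1) q_half by auto
  have "ln (\<Phi> (insert e F) / fact (card V)) = ln (\<Phi> F / fact (card V) * (1 - q))"
    by (simp add: \<Phi>)
  also have "\<dots> = ln (\<Phi> F / fact (card V)) + ln (1 - q)" using pos by (subst ln_mult) auto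
  finally have ln: "ln (\<Phi> (insert e F) / fact (card V)) = ln (\<Phi> F / fact (card V)) + ln (1 - q)" .
  have c: "2 * real (card (insert e F)) / n = 2 * real (card F) / n + 2 / n"
    "120 * (real d + 1) * real (card (insert e F)) / n\<^sup>2 =
      120 * (real d + 1) * real (card F) / n\<^sup>2 + 120 * (real d + 1) / n\<^sup>2"
    using insert.hyps by (simp_all add: add_divide_distrib distrib_left)
  have "\<Phi> (insert e F) > 0" using \<Phi> IH(1) pos by simp
  then show ?case unfolding ln c using IH(2) ln_q by linarith
qed

section \<open>From vertex orders to cycles\<close>

lemma card_edge_of_cycle:
  assumes "distinct vs" "2 \<le> length vs" "e \<in> cycle_edges vs"
  shows "card e = 2"
proof -
  obtain i where i: "i < length vs" "e = {vs ! i, vs ! (Suc i mod length vs)}"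
    using assms(3) by (auto simp: cycle_edges_def)
  have "Suc i mod length vs < length vs" "Suc i mod length vs \<noteq> i"
    using i(1) assms(2) by (auto simp: mod_Suc)
  then have "vs ! i \<noteq> vs ! (Suc i mod length vs)"
    using assms(1) i(1) by (metis nth_eq_iff_index_eq)
  then show ?thesis using i by simp
qed

text \<open>If the edges at two different positions coincided, each position would be the cyclic
  successor of the other, which is impossible for length at least 3.\<close>

lemma card_cycle_edges:
  assumes "distinct vs" "3 \<le> length vs"
  shows "card (cycle_edges vs) = length vs"
proof -
  let ?n = "length vs"
  have "inj_on (\<lambda>i. {vs ! i, vs ! (Suc i mod ?n)}) {..<?n}"
  proof (rule inj_onI)
    fix i j assume ij: "i \<in> {..<?n}" "j \<in> {..<?n}"
      and eq: "{vs ! i, vs ! (Suc i mod ?n)} = {vs ! j, vs ! (Suc j mod ?n)}"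
    have lt: "Suc i mod ?n < ?n" "Suc j mod ?n < ?n" using assms by (auto intro: mod_less_divisor)
    have "i = j \<or> (i = Suc j mod ?n \<and> Suc i mod ?n = j)"
      using eq ij lt assms(1) by (auto simp: doubleton_eq_iff nth_eq_iff_index_eq)
    then show "i = j" using ij assms(2) by (auto simp: mod_Suc split: if_splits)
  qed
  moreover have "cycle_edges vs = (\<lambda>i. {vs ! i, vs ! (Suc i mod ?n)}) ` {..<?n}"
    by (auto simp: cycle_edges_def)
  ultimately show ?thesis by (simp add: card_image)
qed

text \<open>After rotating \<open>x\<close> to the front, its neighbours can only be the second and
  the last vertex.\<close>

lemma degree_cycle_edges_le:
  assumes "distinct vs" "2 \<le> length vs"
  shows "card {y \<in> V. {x, y} \<in> cycle_edges vs} \<le> 2"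
proof (cases "x \<in> set vs")
  case True
  then obtain i where i: "i < length vs" "vs ! i = x" by (auto simp: in_set_conv_nth)
  define ws where "ws = rotate i vs"
  have ws: "cycle_edges ws = cycle_edges vs" "distinct ws" "2 \<le> length ws"
    using assms by (auto simp: ws_def cycle_edges_rotate)
  have hd: "hd ws = x" unfolding ws_def using i by (subst hd_rotate_conv_nth) auto
  have "{y \<in> V. {x, y} \<in> cycle_edges vs} \<subseteq> {ws ! 1, last ws}"
  proof
    fix y assume "y \<in> {y \<in> V. {x, y} \<in> cycle_edges vs}"
    then have y: "{x, y} \<in> cycle_edges vs" by simp
    then have "card {x, y} = 2" using card_edge_of_cycle assms by blast
    then have "y \<noteq> x" by auto
    then show "y \<in> {ws ! 1, last ws}"
      using doubleton_hd_in_cycle_edges_iff[of ws y] ws hd y by auto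
  qed
  then have "card {y \<in> V. {x, y} \<in> cycle_edges vs} \<le> card {ws ! 1, last ws}"
    by (intro card_mono) auto
  also have "\<dots> \<le> 2" by (simp add: card_insert_if)
  finally show ?thesis .
next
  case False
  then have "{y \<in> V. {x, y} \<in> cycle_edges vs} = {}" using cycle_edges_subset_Pow[of vs] by auto
  then show ?thesis by (simp only: card.empty)
qed

lemma hamilton_cycles_complete:
  assumes "3 \<le> n"
  shows "hamilton_cycles {..<n} (complete_graph n) = cycle_edges ` permutations_of_set {..<n}"
proof -
  have "3 \<le> length vs \<and> cycle_edges vs \<subseteq> complete_graph n"
    if "distinct vs" "set vs = {..<n}" for vs
  proof -
    have "length vs = n" using that distinct_card by fastforce
    then show ?thesis
      using cycle_edges_subset_Pow[of vs] card_edge_of_cycle[of vs] that assms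
      by (auto simp: complete_graph_def)
  qed
  then show ?thesis
    by (auto simp: hamilton_cycles_def permutations_of_set_def image_iff)
qed

text \<open>Relabelling the vertices moves any Hamilton cycle to any other one, so all fibres of
  \<^const>\<open>cycle_edges\<close> have the same size.\<close>

lemma card_cycle_edges_fibre_le:
  assumes "vs \<in> permutations_of_set V" "ws \<in> permutations_of_set V"
  shows "card {xs \<in> permutations_of_set V. cycle_edges xs = cycle_edges vs}
       \<le> card {xs \<in> permutations_of_set V. cycle_edges xs = cycle_edges ws}"
proof -
  \<comment> \<open>\<open>f\<close> sends the \<open>i\<close>-th vertex of \<open>vs\<close> to
    the \<open>i\<close>-th vertex of \<open>ws\<close>, so it permutes \<open>V\<close> and carries
    one cycle to the other.\<close>
  define f where "f x = the (map_of (zip vs ws) x)" for x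
  have len: "length vs = length ws" "distinct vs" "distinct ws" "set vs = V" "set ws = V"
    using assms by (auto simp: permutations_of_set_def simp flip: distinct_card)
  have f: "map f vs = ws"
    using len by (intro nth_equalityI) (auto simp: f_def map_of_zip_nth)
  then have "f ` V = V" using len by (metis set_map)
  have "inj_on f V" using f len by (metis distinct_map)
  have "inj_on (map f) {xs \<in> permutations_of_set V. cycle_edges xs = cycle_edges vs}"
    using \<open>inj_on f V\<close>
    by (intro inj_on_mapI inj_on_subset[OF \<open>inj_on f V\<close>]) (auto simp: permutations_of_set_def)
  moreover have "map f ` {xs \<in> permutations_of_set V. cycle_edges xs = cycle_edges vs} \<subseteq>
     {xs \<in> permutations_of_set V. cycle_edges xs = cycle_edges ws}"
    using \<open>inj_on f V\<close> \<open>f ` V = V\<close> f cycle_edges_map[of f vs]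
    by (auto simp: permutations_of_set_def distinct_map cycle_edges_map)
  ultimately show ?thesis by (intro card_inj_on_le) auto
qed

text \<open>Every cycle is represented by the same number \<open>c\<close> of orders, which cancels;
  the denominator is the count for the empty forbidden set.\<close>

lemma fraction_avoiding_eq:
  fixes F :: "'a set set"
  assumes "finite V"
  defines "C \<equiv> cycle_edges ` permutations_of_set V"
  shows "real (card {h \<in> C. h \<inter> F = {}}) / card C = card (ham_orders V F {}) / fact (card V)"
proof -
  let ?P = "permutations_of_set V"
  obtain vs0 where vs0: "vs0 \<in> ?P" using assms(1) permutations_of_set_empty_iff[of V] by blast
  define c where "c = card {xs \<in> ?P. cycle_edges xs = cycle_edges vs0}"
  have fib: "card {xs \<in> ?P. cycle_edges xs = h} = c" if h: "h \<in> C" for h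
  proof -
    obtain vs where "vs \<in> ?P" "h = cycle_edges vs" using h by (auto simp: C_def)
    then show ?thesis
      unfolding c_def
      using card_cycle_edges_fibre_le[of vs V vs0] card_cycle_edges_fibre_le[of vs0 V vs] vs0 by simp
  qed
  have "finite C" by (simp add: C_def)
  have count: "card {xs \<in> ?P. cycle_edges xs \<inter> F = {}} = card {h \<in> C. h \<inter> F = {}} * c" for F
  proof -
    have "{xs \<in> ?P. cycle_edges xs \<inter> F = {}} =
        (\<Union>h\<in>{h \<in> C. h \<inter> F = {}}. {xs \<in> ?P. cycle_edges xs = h})"
      by (auto simp: C_def)
    also have "card \<dots> = (\<Sum>h\<in>{h \<in> C. h \<inter> F = {}}. card {xs \<in> ?P. cycle_edges xs = h})"
      using \<open>finite C\<close> by (subst card_UN_disjoint) auto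
    also have "\<dots> = (\<Sum>h\<in>{h \<in> C. h \<inter> F = {}}. c)" by (rule sum.cong) (auto simp: fib)
    finally show ?thesis by simp
  qed
  have "fact (card V) = card C * c" using count[of "{}"] assms(1) by simp
  then have tot: "fact (card V) = real (card C) * real c" by (metis of_nat_fact of_nat_mult)
  have "real c \<noteq> 0"
  proof
    assume "real c = 0"
    then show False using tot fact_nonzero[of "card V", where ?'a = real] by simp
  qed
  moreover have "card (ham_orders V F {}) = card {h \<in> C. h \<inter> F = {}} * c"
    using count[of F] by (simp add: ham_orders_def)
  ultimately show ?thesis unfolding tot by simp
qed

section \<open>Tuples of pairwise disjoint cycles\<close>

text \<open>By disjointness the union \<open>G\<close> has exactly \<open>k * n\<close> edges, and
  its degrees are at most \<open>2 * k\<close>. Now \<open>ln_card_ham_orders\<close> with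
  \<open>d = 2 * k\<close> has main term \<open>2 * k\<close> and error
  \<open>120 * (2 * k + 1) * k / n\<close>, which is at most \<open>360 * k^2 / n\<close> because
  \<open>k <= k^2\<close>.\<close>

lemma fraction_avoiding_disjoint_cycles:
  fixes n k :: nat and H :: "nat \<Rightarrow> nat set set"
  assumes n: "16 + 8 * k \<le> n"
    and H: "\<And>i. i \<in> {1..k} \<Longrightarrow> H i \<in> hamilton_cycles {..<n} (complete_graph n)"
    and disj: "pairwise (\<lambda>i j. disjnt (H i) (H j)) {1..k}"
  defines "C \<equiv> hamilton_cycles {..<n} (complete_graph n)"
  defines "q \<equiv> real (card {h \<in> C. h \<inter> (\<Union>i\<in>{1..k}. H i) = {}}) / card C"
  shows "exp (- 2 * real k - 360 * (real k)\<^sup>2 / n) \<le> q \<and> q \<le> exp (- 2 * real k + 360 * (real k)\<^sup>2 / n)"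
proof -
  define G where "G = (\<Union>i\<in>{1..k}. H i)"
  have cyc: "\<exists>vs. H i = cycle_edges vs \<and> distinct vs \<and> set vs = {..<n} \<and> length vs = n"
    if i: "i \<in> {1..k}" for i
  proof -
    obtain vs where "H i = cycle_edges vs" "vs \<in> permutations_of_set {..<n}"
      using H[OF i] n by (auto simp: hamilton_cycles_complete)
    then show ?thesis using distinct_card[of vs] by (auto simp: permutations_of_set_def)
  qed
  have finH: "finite (H i)" if "i \<in> {1..k}" for i
    using cyc[OF that] finite_cycle_edges by auto
  have "card G = (\<Sum>i\<in>{1..k}. card (H i))"
    unfolding G_def using finH disj
    by (intro card_UN_disjoint) (auto simp: pairwise_def disjnt_def)
  also have "\<dots> = (\<Sum>i\<in>{1..k}. n)"
    by (rule sum.cong [OF refl]) (use cyc card_cycle_edges n in force)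
  finally have cardG: "card G = k * n" by simp
  have finG: "finite G" unfolding G_def using finH by auto
  have subG: "G \<subseteq> {e. e \<subseteq> {..<n} \<and> card e = 2}"
  proof -
    have "H i \<subseteq> complete_graph n" if "i \<in> {1..k}" for i
      using H[OF that] by (auto simp: hamilton_cycles_def)
    then show ?thesis unfolding G_def complete_graph_def by blast
  qed
  have degG: "card {y \<in> {..<n}. {x, y} \<in> G} \<le> 2 * k" for x
  proof -
    have "{y \<in> {..<n}. {x, y} \<in> G} = (\<Union>i\<in>{1..k}. {y \<in> {..<n}. {x, y} \<in> H i})"
      by (auto simp: G_def)
    also have "card \<dots> \<le> (\<Sum>i\<in>{1..k}. card {y \<in> {..<n}. {x, y} \<in> H i})"
      by (rule card_UN_le) simp
    also have "\<dots> \<le> (\<Sum>i\<in>{1..k}. 2)"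
    proof (rule sum_mono)
      fix i assume "i \<in> {1..k}"
      then obtain vs where "H i = cycle_edges vs" "distinct vs" "length vs = n" using cyc by blast
      then show "card {y \<in> {..<n}. {x, y} \<in> H i} \<le> 2"
        using degree_cycle_edges_le[of vs "{..<n}" x] n by simp
    qed
    finally show ?thesis by simp
  qed
  have "q = card (ham_orders {..<n} G {}) / fact n"
    unfolding q_def C_def G_def[symmetric]
    using fraction_avoiding_eq[of "{..<n}" G] n by (simp add: hamilton_cycles_complete)
  moreover have "0 < real (card (ham_orders {..<n} G {})) \<and>
    \<bar>ln (real (card (ham_orders {..<n} G {})) / fact (card {..<n})) + 2 * real (card G) / real (card {..<n})\<bar>
      \<le> 120 * (real (2 * k) + 1) * real (card G) / (real (card {..<n}))\<^sup>2"
    using n degG by (intro ln_card_ham_orders finG subG) auto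
  ultimately have q: "q > 0" "\<bar>ln q + 2 * real (card G) / n\<bar> \<le> 120 * (real (2 * k) + 1) * real (card G) / (real n)\<^sup>2"
    by auto
  have 1: "2 * real (card G) / n = 2 * real k" using n by (simp add: cardG)
  have "120 * (real (2 * k) + 1) * real (card G) / (real n)\<^sup>2 = 120 * ((2 * real k + 1) * real k) / n"
    using n by (simp add: cardG power2_eq_square)
  also have "\<dots> \<le> 120 * (3 * (real k)\<^sup>2) / n"
  proof (intro divide_right_mono mult_left_mono)
    have "k \<le> k * k" by (cases k) auto
    then have "real k \<le> real k * real k" by (simp flip: of_nat_mult)
    then show "(2 * real k + 1) * real k \<le> 3 * (real k)\<^sup>2"
      by (simp add: power2_eq_square algebra_simps)
  qed auto
  finally have "\<bar>ln q + 2 * real k\<bar> \<le> 360 * (real k)\<^sup>2 / n" using q(2) 1 by simp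
  then have "- 2 * real k - 360 * (real k)\<^sup>2 / n \<le> ln q" "ln q \<le> - 2 * real k + 360 * (real k)\<^sup>2 / n"
    by (auto simp: abs_le_iff)
  then show ?thesis using q(1) by (metis exp_le_cancel_iff exp_ln)
qed

text \<open>The default \<open>{}\<close> outside \<open>{1..k}\<close> is the one used by
  \<open>random_hamilton_cycles\<close>, so that these tuples are exactly the outcomes to be
  counted.\<close>

definition disjoint_tuples :: "'a set set \<Rightarrow> nat \<Rightarrow> (nat \<Rightarrow> 'a set) set" where
  "disjoint_tuples C k =
     {H \<in> PiE_dflt {1..k} {} (\<lambda>_. C). pairwise (\<lambda>i j. disjnt (H i) (H j)) {1..k}}"

lemma finite_disjoint_tuples: "finite C \<Longrightarrow> finite (disjoint_tuples C k)"
  unfolding disjoint_tuples_def by (intro finite_subset[OF _ finite_PiE_dflt]) auto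

text \<open>A disjoint tuple of length \<open>Suc k\<close> is a disjoint tuple of length
  \<open>k\<close> together with one more member of \<open>C\<close> that avoids its union.\<close>

lemma card_disjoint_tuples_Suc:
  assumes "finite C"
  shows "card (disjoint_tuples C (Suc k)) =
    (\<Sum>H\<in>disjoint_tuples C k. card {h \<in> C. h \<inter> (\<Union>i\<in>{1..k}. H i) = {}})"
proof -
  define A where "A H = {h \<in> C. h \<inter> (\<Union>i\<in>{1..k}. H i) = {}}" for H :: "nat \<Rightarrow> 'a set"
  have ins: "{1..Suc k} = insert (Suc k) {1..k}" by auto
  have "bij_betw (\<lambda>(H, h). H(Suc k := h)) (Sigma (disjoint_tuples C k) A) (disjoint_tuples C (Suc k))"
  \<comment> \<open>The inverse resets the entry at \<open>Suc k\<close> to the default, as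
    membership in the shorter tuples demands.\<close>
  proof (rule bij_betw_byWitness[where f' = "\<lambda>H. (H(Suc k := {}), H (Suc k))"])
    have "H(Suc k := {}) = H" if "H \<in> disjoint_tuples C k" for H
      using that by (auto simp: disjoint_tuples_def PiE_dflt_def fun_eq_iff)
    then show "\<forall>p\<in>Sigma (disjoint_tuples C k) A.
        ((case p of (H, h) \<Rightarrow> H(Suc k := h))(Suc k := {}), (case p of (H, h) \<Rightarrow> H(Suc k := h)) (Suc k)) = p"
      by auto
    show "\<forall>H\<in>disjoint_tuples C (Suc k). (case (H(Suc k := {}), H (Suc k)) of (H, h) \<Rightarrow> H(Suc k := h)) = H"
      by auto
    show "(\<lambda>(H, h). H(Suc k := h)) ` Sigma (disjoint_tuples C k) A \<subseteq> disjoint_tuples C (Suc k)"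
    proof clarify
      fix H h assume H: "H \<in> disjoint_tuples C k" and h: "h \<in> A H"
      have "pairwise (\<lambda>i j. disjnt ((H(Suc k := h)) i) ((H(Suc k := h)) j)) {1..Suc k}"
        using H h unfolding ins disjoint_tuples_def A_def
        by (auto simp: pairwise_insert pairwise_def disjnt_def)
      then show "H(Suc k := h) \<in> disjoint_tuples C (Suc k)"
        using H h by (auto simp: disjoint_tuples_def PiE_dflt_def A_def)
    qed
    show "(\<lambda>H. (H(Suc k := {}), H (Suc k))) ` disjoint_tuples C (Suc k) \<subseteq> Sigma (disjoint_tuples C k) A"
    proof clarify
      fix H assume H: "H \<in> disjoint_tuples C (Suc k)"
      then have "pairwise (\<lambda>i j. disjnt (H i) (H j)) (insert (Suc k) {1..k})"
        unfolding ins[symmetric] by (simp add: disjoint_tuples_def)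
      then have p: "pairwise (\<lambda>i j. disjnt (H i) (H j)) {1..k}" "\<forall>i\<in>{1..k}. disjnt (H (Suc k)) (H i)"
        by (auto simp: pairwise_insert)
      then have "H(Suc k := {}) \<in> disjoint_tuples C k"
        using H by (auto simp: disjoint_tuples_def PiE_dflt_def pairwise_def)
      moreover have "H (Suc k) \<in> A (H(Suc k := {}))"
        using H p(2) by (auto simp: A_def disjoint_tuples_def PiE_dflt_def disjnt_def)
      ultimately show "H(Suc k := {}) \<in> disjoint_tuples C k \<and> H (Suc k) \<in> A (H(Suc k := {}))" ..
    qed
  qed
  then have "card (disjoint_tuples C (Suc k)) = card (Sigma (disjoint_tuples C k) A)"
    by (simp add: bij_betw_same_card)
  also have "\<dots> = (\<Sum>H\<in>disjoint_tuples C k. card (A H))"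
    using assms finite_disjoint_tuples[OF assms] by (subst card_SigmaI) (auto simp: A_def)
  finally show ?thesis by (simp add: A_def)
qed

text \<open>Independent uniform choices are uniform on the product set, so the probability is a
  ratio of cardinalities.\<close>

lemma prob_random_hamilton_cycles_disjoint:
  assumes "3 \<le> n"
  defines "C \<equiv> hamilton_cycles {..<n} (complete_graph n)"
  shows "measure_pmf.prob (random_hamilton_cycles n k) {H. pairwise (\<lambda>i j. disjnt (H i) (H j)) {1..k}} =
     card (disjoint_tuples C k) / card C ^ k"
proof -
  have C: "finite C" "C \<noteq> {}"
    unfolding C_def hamilton_cycles_complete[OF assms(1)] by auto
  then have ne: "PiE_dflt {1..k} {} (\<lambda>_. C) \<noteq> {}" "finite (PiE_dflt {1..k} {} (\<lambda>_. C))"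
    by (auto simp: PiE_dflt_empty_iff)
  have "random_hamilton_cycles n k = pmf_of_set (PiE_dflt {1..k} {} (\<lambda>_. C))"
    unfolding random_hamilton_cycles_def C_def[symmetric] using C by (intro Pi_pmf_of_set) auto
  moreover have "card (PiE_dflt {1..k} {} (\<lambda>_. C)) = card C ^ k"
    using C by (simp add: card_PiE_dflt)
  ultimately show ?thesis
    using ne by (simp add: measure_pmf_of_set disjoint_tuples_def Int_def)
qed

text \<open>Whatever the first \<open>k\<close> disjoint cycles are, the next one avoids them with
  probability between \<open>exp (- 2 * k - 360 * k^2 / n)\<close> and
  \<open>exp (- 2 * k + 360 * k^2 / n)\<close>. Multiplying these estimates sums the main terms to
  \<open>2 * (k choose 2)\<close>, and the summed squares are bounded by a cube through
  \<open>k^2 + k^3 <= (k + 1)^3\<close>.\<close>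

lemma prob_random_hamilton_cycles_disjoint_bounds:
  fixes n k :: nat
  assumes "16 + 8 * k \<le> n"
  defines "p \<equiv> \<lambda>k. measure_pmf.prob (random_hamilton_cycles n k) {H. pairwise (\<lambda>i j. disjnt (H i) (H j)) {1..k}}"
  shows "exp (- 2 * real (k choose 2) - 360 * real k ^ 3 / n) \<le> p k \<and>
         p k \<le> exp (- 2 * real (k choose 2) + 360 * real k ^ 3 / n)"
  using assms(1)
proof (induction k)
  case 0
  have "pairwise R {}" for R :: "nat \<Rightarrow> nat \<Rightarrow> bool" by simp
  then show ?case by (simp add: p_def)
next
  case (Suc k)
  define C where "C = hamilton_cycles {..<n} (complete_graph n)"
  define \<epsilon> where "\<epsilon> = 360 * (real k)\<^sup>2 / n"
  define q where "q H = real (card {h \<in> C. h \<inter> (\<Union>i\<in>{1..k}. H i) = {}}) / card C" for H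
  have n: "16 + 8 * k \<le> n" "3 \<le> n" using Suc.prems by auto
  have C: "finite C" "C \<noteq> {}"
    unfolding C_def hamilton_cycles_complete[OF n(2)] by auto
  have p: "p k = card (disjoint_tuples C k) / card C ^ k" for k
    unfolding p_def C_def by (rule prob_random_hamilton_cycles_disjoint[OF n(2)])
  have q: "exp (- 2 * real k - \<epsilon>) \<le> q H" "q H \<le> exp (- 2 * real k + \<epsilon>)" if "H \<in> disjoint_tuples C k" for H
    using fraction_avoiding_disjoint_cycles[of k n H] n that
    unfolding q_def C_def \<epsilon>_def disjoint_tuples_def PiE_dflt_def by auto
  \<comment> \<open>One of the \<open>Suc k\<close> factors \<open>card C\<close> is absorbed into
    \<open>q\<close>; uniform bounds on \<open>q\<close> then compare the sum with
    \<open>p k\<close>.\<close>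
  have pSuc: "p (Suc k) = (\<Sum>H\<in>disjoint_tuples C k. q H) / card C ^ k"
    unfolding p card_disjoint_tuples_Suc[OF C(1)] q_def sum_divide_distrib[symmetric]
    by (simp add: mult.commute)
  have lower: "exp (- 2 * real k - \<epsilon>) * p k \<le> p (Suc k)"
  proof -
    have "(\<Sum>H\<in>disjoint_tuples C k. exp (- 2 * real k - \<epsilon>)) \<le> (\<Sum>H\<in>disjoint_tuples C k. q H)"
      using q(1) by (rule sum_mono)
    then show ?thesis
      unfolding pSuc unfolding p by (auto simp: mult.commute intro!: divide_right_mono)
  qed
  have upper: "p (Suc k) \<le> exp (- 2 * real k + \<epsilon>) * p k"
  proof -
    have "(\<Sum>H\<in>disjoint_tuples C k. q H) \<le> (\<Sum>H\<in>disjoint_tuples C k. exp (- 2 * real k + \<epsilon>))"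
      using q(2) by (rule sum_mono)
    then show ?thesis
      unfolding pSuc unfolding p by (auto simp: mult.commute intro!: divide_right_mono)
  qed
  have choose: "real (Suc k choose 2) = real k + real (k choose 2)"
    by (simp add: numeral_2_eq_2)
  have "(real k)\<^sup>2 + real k ^ 3 \<le> real (Suc k) ^ 3"
    by (simp add: power2_eq_square power3_eq_cube algebra_simps)
  then have "360 * ((real k)\<^sup>2 + real k ^ 3) / n \<le> 360 * real (Suc k) ^ 3 / n"
    by (intro divide_right_mono mult_left_mono) auto
  then have err: "\<epsilon> + 360 * real k ^ 3 / n \<le> 360 * real (Suc k) ^ 3 / n"
    by (simp add: \<epsilon>_def distrib_left add_divide_distrib)
  have IH: "exp (- 2 * real (k choose 2) - 360 * real k ^ 3 / n) \<le> p k"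
    "p k \<le> exp (- 2 * real (k choose 2) + 360 * real k ^ 3 / n)" using Suc.IH n by auto
  have "exp (- 2 * real (Suc k choose 2) - 360 * real (Suc k) ^ 3 / n) \<le>
     exp (- 2 * real k - \<epsilon>) * exp (- 2 * real (k choose 2) - 360 * real k ^ 3 / n)"
    unfolding exp_add[symmetric] exp_le_cancel_iff choose using err by (simp add: algebra_simps)
  also have "\<dots> \<le> exp (- 2 * real k - \<epsilon>) * p k" using IH by (intro mult_left_mono) auto
  also note lower
  finally have 1: "exp (- 2 * real (Suc k choose 2) - 360 * real (Suc k) ^ 3 / n) \<le> p (Suc k)" .
  note upper
  also have "exp (- 2 * real k + \<epsilon>) * p k \<le>
      exp (- 2 * real k + \<epsilon>) * exp (- 2 * real (k choose 2) + 360 * real k ^ 3 / n)"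
    using IH by (intro mult_left_mono) auto
  also have "\<dots> \<le> exp (- 2 * real (Suc k choose 2) + 360 * real (Suc k) ^ 3 / n)"
    unfolding exp_add[symmetric] exp_le_cancel_iff choose using err by (simp add: algebra_simps)
  finally show ?case using 1 by blast
qed

section \<open>Asymptotics for slowly growing k\<close>

theorem theorem1:
  fixes k :: "nat \<Rightarrow> nat"
  assumes "(\<lambda>n. real (k n)) \<in> o(\<lambda>n. real n powr (1 / 100))"
  shows "(\<lambda>n. measure_pmf.prob (random_hamilton_cycles n (k n))
                {H. pairwise (\<lambda>i j. disjnt (H i) (H j)) {1..k n}})
           \<sim>[at_top] (\<lambda>n. exp (- 2 * real (k n choose 2)))"
proof -
  define p where "p n = measure_pmf.prob (random_hamilton_cycles n (k n))
                {H. pairwise (\<lambda>i j. disjnt (H i) (H j)) {1..k n}}" for n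
  define E where "E n = 360 * real (k n) ^ 3 / real n" for n
  \<comment> \<open>From \<open>k <= n powr (1 / 100)\<close> follow both the size condition
    \<open>16 + 8 * k <= n\<close> for large \<open>n\<close> and the convergence of
    \<open>k^3 / n\<close> to 0, which squeezes the ratio between \<open>exp (- E n)\<close> and
    \<open>exp (E n)\<close>.\<close>
  have k_le: "\<forall>\<^sub>F n in at_top. real (k n) \<le> real n powr (1 / 100)"
    using landau_o.smallD[OF assms, of 1] by simp
  have "\<forall>\<^sub>F n :: nat in at_top. 16 + 8 * (real n powr (1 / 100)) \<le> real n" by real_asymp
  with k_le have large: "\<forall>\<^sub>F n in at_top. 16 + 8 * k n \<le> n"
  proof eventually_elim
    case (elim n)
    then have "real (16 + 8 * k n) \<le> real n" by simp
    then show ?case by (simp only: of_nat_le_iff)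
  qed
  have E: "E \<longlonglongrightarrow> 0"
  proof (rule tendsto_sandwich[OF _ _ tendsto_const])
    show "\<forall>\<^sub>F n in at_top. 0 \<le> E n" by (simp add: E_def)
    show "\<forall>\<^sub>F n in at_top. E n \<le> 360 * (real n powr (1 / 100)) ^ 3 / real n"
      using k_le unfolding E_def
      by eventually_elim (intro divide_right_mono mult_left_mono power_mono, auto)
    show "(\<lambda>n :: nat. 360 * (real n powr (1 / 100)) ^ 3 / real n) \<longlonglongrightarrow> 0" by real_asymp
  qed
  have "(\<lambda>n. p n / exp (- 2 * real (k n choose 2))) \<longlonglongrightarrow> 1"
  proof (rule tendsto_sandwich)
    have bounds: "\<forall>\<^sub>F n in at_top. exp (- E n) \<le> p n / exp (- 2 * real (k n choose 2)) \<and>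
        p n / exp (- 2 * real (k n choose 2)) \<le> exp (E n)"
      using large
    proof eventually_elim
      case (elim n)
      from prob_random_hamilton_cycles_disjoint_bounds[OF this]
      have "exp (- 2 * real (k n choose 2)) * exp (- E n) \<le> p n"
        "p n \<le> exp (- 2 * real (k n choose 2)) * exp (E n)"
        unfolding p_def E_def exp_add[symmetric] by simp_all
      then show ?case by (simp add: pos_le_divide_eq pos_divide_le_eq mult.commute)
    qed
    show "\<forall>\<^sub>F n in at_top. exp (- E n) \<le> p n / exp (- 2 * real (k n choose 2))"
      "\<forall>\<^sub>F n in at_top. p n / exp (- 2 * real (k n choose 2)) \<le> exp (E n)"
      using bounds by (auto elim: eventually_mono)
    show "(\<lambda>n. exp (- E n)) \<longlonglongrightarrow> 1" "(\<lambda>n. exp (E n)) \<longlonglongrightarrow> 1"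
      using tendsto_exp[OF tendsto_minus[OF E]] tendsto_exp[OF E] by simp_all
  qed
  then show ?thesis
    unfolding p_def by (intro asymp_equivI') auto
qed

end
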